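(* Let $N\ge2$, let $\Sigma\subset\mathbb{C}^N$ be compact, and let $k$ be an integer with $2\le k\le N$. If $K\subset\widehat{\Sigma}^{\,k}$ is a compact polynomially convex set, then there is a compact subset $X$ of $\Sigma$ such that $h_r^{k-1}(X)\supset K$ and the set $\widehat{X}\setminus K$ contains no analytic discs.
   Context: Let $X\subset\mathbb{C}^N$ be compact. An analytic subvariety of $\mathbb{C}^N$ of pure codimension $m$ means a pure-dimensional analytic subvariety of $\mathbb{C}^N$ of dimension $N-m$. The polynomial hull is $\widehat{X}=\{z: |p(z)|\le\max_X|p| \text{ for all polynomials } p\}$; $X$ is polynomially convex if $\widehat X=X$. For $1\le k\le N$, the $k$-rational hull $h_r^k(X)$ is the set of $z\in\mathbb{C}^N$ such that every analytic subvariety of $\mathbb{C}^N$ of pure codimension $\le k$ that passes through $z$ intersects $X$. For $2\le k\le N$ the $k$-polynomial hull $\widehat{X}^{\,k}$ is the set of $z\in\mathbb{C}^N$ such that $z\in h_r^{k-1}(X)$ and $z\in\widehat{X\cap V}$ for every analytic subvariety $V$ of $\mathbb{C}^N$ of pure codimension $\le k-1$ passing through $z$. An analytic disc is an injective holomorphic map $\sigma:D\to\mathbb{C}^N$ ($D$ the open unit disc); a set contains no analytic discs if no analytic disc has image in it. *)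

theory Defs
  imports "HOL-Analysis.Analysis"
begin

inductive_set cpoly :: "(complex^'n \<Rightarrow> complex) set" where
  const: "(\<lambda>z. c) \<in> cpoly"
| coord: "(\<lambda>z. z $ i) \<in> cpoly"
| add: "p \<in> cpoly \<Longrightarrow> q \<in> cpoly \<Longrightarrow> (\<lambda>z. p z + q z) \<in> cpoly"
| mult: "p \<in> cpoly \<Longrightarrow> q \<in> cpoly \<Longrightarrow> (\<lambda>z. p z * q z) \<in> cpoly"

text \<open>Polynomial hull (the max over the empty set is -infinity, so the hull of {} is {}).\<close>
definition poly_hull :: "(complex^'n) set \<Rightarrow> (complex^'n) set" where
  "poly_hull X = {z. X \<noteq> {} \<and>
      (\<forall>p\<in>cpoly. cmod (p z) \<le> (SUP x\<in>X. cmod (p x)))}"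

definition clinear_fun :: "(complex^'n \<Rightarrow> complex) \<Rightarrow> bool" where
  "clinear_fun D \<longleftrightarrow> linear D \<and> (\<forall>c v. D (c *s v) = c * D v)"

definition cholo_on :: "(complex^'n) set \<Rightarrow> (complex^'n \<Rightarrow> complex) \<Rightarrow> bool" where
  "cholo_on U f \<longleftrightarrow> (\<forall>z\<in>U. \<exists>D. (f has_derivative D) (at z) \<and> clinear_fun D)"

definition analytic_subvariety :: "(complex^'n) set \<Rightarrow> bool" where
  "analytic_subvariety V \<longleftrightarrow> closed V \<and>
     (\<forall>a\<in>V. \<exists>U (r::nat) (g :: nat \<Rightarrow> complex^'n \<Rightarrow> complex).
         open U \<and> a \<in> U \<and> (\<forall>j<r. cholo_on U (g j)) \<and>
         V \<inter> U = {z\<in>U. \<forall>j<r. g j z = 0})"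

text \<open>a is a regular point of V at which V is a complex submanifold of codimension m:
  near a, V is cut out by m holomorphic functions with C-linearly independent differentials.\<close>
definition regular_codim :: "(complex^'n) set \<Rightarrow> complex^'n \<Rightarrow> nat \<Rightarrow> bool" where
  "regular_codim V a m \<longleftrightarrow> a \<in> V \<and>
     (\<exists>U (g :: nat \<Rightarrow> complex^'n \<Rightarrow> complex) (D :: nat \<Rightarrow> complex^'n \<Rightarrow> complex^'n \<Rightarrow> complex).
         open U \<and> a \<in> U \<and>
         (\<forall>j<m. \<forall>z\<in>U. (g j has_derivative D j z) (at z) \<and> clinear_fun (D j z)) \<and>
         (\<forall>z\<in>U. \<forall>w :: nat \<Rightarrow> complex. \<exists>v. \<forall>j<m. D j z v = w j) \<and>
         V \<inter> U = {z\<in>U. \<forall>j<m. g j z = 0})"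

text \<open>Analytic subvariety of pure codimension m (pure dimension N - m): every regular point
  has codimension m (regular points are dense in any analytic set).\<close>
definition pure_codim_subvariety :: "(complex^'n) set \<Rightarrow> nat \<Rightarrow> bool" where
  "pure_codim_subvariety V m \<longleftrightarrow> analytic_subvariety V \<and> m \<le> CARD('n) \<and>
     (\<forall>a m'. regular_codim V a m' \<longrightarrow> m' = m)"

definition rat_hull :: "nat \<Rightarrow> (complex^'n) set \<Rightarrow> (complex^'n) set" where
  "rat_hull k X = {z. \<forall>V m. m \<le> k \<longrightarrow> pure_codim_subvariety V m \<longrightarrow> z \<in> V \<longrightarrow> V \<inter> X \<noteq> {}}"

definition kpoly_hull :: "nat \<Rightarrow> (complex^'n) set \<Rightarrow> (complex^'n) set" where
  "kpoly_hull k X = {z. z \<in> rat_hull (k - 1) X \<and>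
      (\<forall>V m. m \<le> k - 1 \<longrightarrow> pure_codim_subvariety V m \<longrightarrow> z \<in> V \<longrightarrow> z \<in> poly_hull (X \<inter> V))}"

definition analytic_disc :: "(complex \<Rightarrow> complex^'n) \<Rightarrow> bool" where
  "analytic_disc \<sigma> \<longleftrightarrow> inj_on \<sigma> (ball 0 1) \<and> (\<forall>i. (\<lambda>\<zeta>. \<sigma> \<zeta> $ i) holomorphic_on ball 0 1)"

definition contains_no_discs :: "(complex^'n) set \<Rightarrow> bool" where
  "contains_no_discs S \<longleftrightarrow> \<not> (\<exists>\<sigma>. analytic_disc \<sigma> \<and> \<sigma> ` ball 0 1 \<subseteq> S)"

end

theory Submission
  imports Defs "HOL-Complex_Analysis.Conformal_Mappings"
begin

text \<open>
  Fix countably many polynomials \<open>q\<^sub>j\<close> with \<open>|q\<^sub>j| < 1\<close> on \<open>K\<close> such that, by polynomial convexity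
  of \<open>K\<close> and the open mapping theorem, every analytic disc outside \<open>K\<close> meets some hypersurface
  \<open>{q\<^sub>j = 1}\<close>.  It then suffices that the hull of \<open>X\<close> avoids all these hypersurfaces.
  Construct polynomials \<open>F\<^sub>j\<close>, close to \<open>1\<close> on \<open>K\<close>, by \<open>F\<^sub>j\<^sub>+\<^sub>1 = \<psi>\<^sub>j(F\<^sub>j) (1 - q\<^sub>j\<^sup>n)\<close>, where \<open>n\<close> is
  large and \<open>\<psi>\<^sub>j\<close> is a one-variable polynomial that is nearly \<open>1\<close> near \<open>1\<close> and so small on
  \<open>F\<^sub>j(\<Sigma>) \<inter> {Re w \<le> 1/2}\<close> that the sets \<open>\<Sigma> \<inter> {Re F\<^sub>j \<ge> 1/2}\<close> decrease; \<open>X\<close> is their intersection.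
  Half-planes are used because both a half-plane and its complement are convex: the hull of \<open>X\<close>
  stays in \<open>{Re F\<^sub>j\<^sub>+\<^sub>1 \<ge> 1/2}\<close>, hence off \<open>{q\<^sub>j = 1}\<close>, while a point \<open>z \<in> K\<close> of the hull of \<open>\<Sigma> \<inter> V\<close>
  forces \<open>V\<close> to meet every \<open>\<Sigma> \<inter> {Re F\<^sub>j \<ge> 1/2}\<close>.
\<close>

section \<open>Polynomials and polynomial hulls\<close>

lemma cpoly_diff: "p \<in> cpoly \<Longrightarrow> q \<in> cpoly \<Longrightarrow> (\<lambda>z. p z - q z) \<in> cpoly"
  using cpoly.add[OF _ cpoly.mult[OF cpoly.const[of "-1"]], of p q] by simp

lemma cpoly_power: "p \<in> cpoly \<Longrightarrow> (\<lambda>z. p z ^ n) \<in> cpoly"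
  by (induction n) (auto intro: cpoly.intros)

lemma cpoly_divide: "p \<in> cpoly \<Longrightarrow> (\<lambda>z. p z / c) \<in> cpoly"
  using cpoly.mult[OF _ cpoly.const[of "inverse c"], of p] by (simp add: field_simps)

lemma cpoly_poly_comp: "p \<in> cpoly \<Longrightarrow> (\<lambda>z. poly q (p z)) \<in> cpoly"
  by (induction q) (auto intro: cpoly.intros)

lemma continuous_on_cpoly: "p \<in> cpoly \<Longrightarrow> continuous_on A p"
  by (induction rule: cpoly.induct) (auto intro!: continuous_intros)

lemma holomorphic_on_cpoly_comp:
  fixes \<sigma> :: "complex \<Rightarrow> complex^'n"
  assumes "p \<in> cpoly" "\<And>i. (\<lambda>\<zeta>. \<sigma> \<zeta> $ i) holomorphic_on A"
  shows "(\<lambda>\<zeta>. p (\<sigma> \<zeta>)) holomorphic_on A"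
  using assms by (induction rule: cpoly.induct) (auto intro!: holomorphic_intros)

lemma compact_cpoly_bounded:
  assumes "compact Y" "p \<in> cpoly"
  obtains B where "0 < B" "\<And>y. y \<in> Y \<Longrightarrow> cmod (p y) \<le> B"
proof -
  have "compact (p ` Y)"
    using assms by (intro compact_continuous_image continuous_on_cpoly)
  then have "bounded (p ` Y)" by (rule compact_imp_bounded)
  then show ?thesis using that by (auto simp: bounded_pos)
qed

text \<open>Polynomial hulls control moduli, whereas the construction works with half-planes.
  Applied to \<open>p\<close> this finds points of the compact set far to the right; applied to
  \<open>-p\<close> it confines the hull to a half-plane.\<close>

lemma poly_hull_Re_ge:
  assumes "compact Y" "z \<in> poly_hull Y" "p \<in> cpoly"
  shows "\<exists>y\<in>Y. Re (p y) \<ge> Re (p z)"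
proof (rule ccontr)
  assume "\<not> ?thesis"
  then have less: "Re (p y) < Re (p z)" if "y \<in> Y" for y using that by force
  have ne: "Y \<noteq> {}" using assms(2) by (simp add: poly_hull_def)
  define f where "f = (\<lambda>w. p w - p z)"
  have f: "f \<in> cpoly" unfolding f_def using assms(3) by (intro cpoly_diff cpoly.const)
  have "continuous_on Y (\<lambda>w. Re (f w))"
    using continuous_on_cpoly[OF f] by (intro continuous_intros)
  then obtain y0 where y0: "y0 \<in> Y" "\<And>y. y \<in> Y \<Longrightarrow> Re (f y) \<le> Re (f y0)"
    using continuous_attains_sup[OF assms(1) ne] by blast
  define d where "d = - Re (f y0)"
  have d: "d > 0" using less[OF y0(1)] by (simp add: d_def f_def)
  obtain B where B: "0 < B" "\<And>y. y \<in> Y \<Longrightarrow> cmod (f y) \<le> B"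
    using compact_cpoly_bounded[OF assms(1) f] by blast
  \<comment> \<open>A large disc centred far to the left replaces the half-plane.\<close>
  define R where "R = B\<^sup>2 / d"
  have R: "R > 0" using B d by (simp add: R_def)
  define g where "g = (\<lambda>w. f w + of_real R)"
  have g: "g \<in> cpoly" unfolding g_def using f by (intro cpoly.add cpoly.const)
  have lt: "cmod (g y) < R" if y: "y \<in> Y" for y
  proof -
    have "(cmod (g y))\<^sup>2 = R\<^sup>2 + 2 * R * Re (f y) + (cmod (f y))\<^sup>2"
      by (simp add: g_def cmod_power2) (simp add: power2_eq_square algebra_simps)
    also have "\<dots> \<le> R\<^sup>2 + 2 * R * (- d) + B\<^sup>2"
      using y0(2)[OF y] B(2)[OF y] R d
      by (intro add_mono mult_left_mono power_mono) (auto simp: d_def)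
    \<comment> \<open>With \<open>R = B\<^sup>2 / d\<close> the middle term equals -2 B^2, which
      outweighs the last term B^2.\<close>
    also have "\<dots> < R\<^sup>2" using B d by (simp add: R_def)
    finally show ?thesis using R by (simp add: power2_less_imp_less)
  qed
  have "continuous_on Y (\<lambda>w. cmod (g w))"
    using continuous_on_cpoly[OF g] by (intro continuous_intros)
  then obtain y1 where y1: "y1 \<in> Y" "\<And>y. y \<in> Y \<Longrightarrow> cmod (g y) \<le> cmod (g y1)"
    using continuous_attains_sup[OF assms(1) ne] by blast
  have "cmod (g z) \<le> (SUP x\<in>Y. cmod (g x))"
    using assms(2) g by (simp add: poly_hull_def)
  also have "\<dots> \<le> cmod (g y1)" using y1 ne by (intro cSUP_least) auto
  also have "\<dots> < R" using lt y1 by simp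
  finally show False using R by (simp add: g_def f_def)
qed

lemma poly_hull_Re_le:
  assumes "compact Y" "z \<in> poly_hull Y" "p \<in> cpoly"
  shows "\<exists>y\<in>Y. Re (p y) \<le> Re (p z)"
  using poly_hull_Re_ge[OF assms(1,2) cpoly_diff[OF cpoly.const[of 0] assms(3)]] by simp

lemma not_in_poly_hull_separate:
  assumes "compact K" "a \<notin> poly_hull K"
  obtains q where "q \<in> cpoly" "1 < cmod (q a)" "\<And>z. z \<in> K \<Longrightarrow> cmod (q z) < 1"
proof (cases "K = {}")
  case True
  then show ?thesis using that[OF cpoly.const[of 2]] by simp
next
  case False
  then obtain p where p: "p \<in> cpoly" "(SUP x\<in>K. cmod (p x)) < cmod (p a)"
    using assms(2) by (force simp: poly_hull_def not_le)
  \<comment> \<open>The strict gap leaves room on both sides: \<open>p\<close> divided by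
    \<open>s\<close> has modulus below 1 on K and above 1 at \<open>a\<close>.\<close>
  then obtain s where s: "(SUP x\<in>K. cmod (p x)) < s" "s < cmod (p a)"
    using dense by blast
  obtain B where "\<And>y. y \<in> K \<Longrightarrow> cmod (p y) \<le> B"
    using compact_cpoly_bounded[OF assms(1) p(1)] by blast
  then have "bdd_above ((\<lambda>x. cmod (p x)) ` K)" by (auto simp: bdd_above_def)
  then have lt: "cmod (p z) < s" if "z \<in> K" for z
    using cSUP_upper[OF that] s(1) by fastforce
  have "0 < s" using lt False norm_ge_zero by (meson all_not_in_conv le_less_trans)
  then show ?thesis
    using that[OF cpoly_divide[OF p(1), of "of_real s"]] lt s(2)
    by (simp add: norm_divide)
qed

section \<open>One-variable polynomials separating 1 from a half-plane\<close>

text \<open>The expansion of (1 + x)^n - 1 has nonnegative coefficients, so the triangle inequality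
  replaces x by its modulus.\<close>

lemma norm_one_plus_power_minus_one_le:
  fixes x :: complex
  shows "cmod ((1 + x) ^ n - 1) \<le> (1 + cmod x) ^ n - 1"
proof (induction n)
  case (Suc n)
  have "(1 + x) ^ Suc n - 1 = (1 + x) * ((1 + x) ^ n - 1) + x" by (simp add: algebra_simps)
  then have "cmod ((1 + x) ^ Suc n - 1) \<le> cmod (1 + x) * cmod ((1 + x) ^ n - 1) + cmod x"
    by (metis norm_mult norm_triangle_ineq)
  also have "\<dots> \<le> (1 + cmod x) * ((1 + cmod x) ^ n - 1) + cmod x"
    using Suc norm_triangle_ineq[of 1 x] by (intro add_mono mult_mono) auto
  finally show ?case by (simp add: algebra_simps)
qed simp

lemma one_plus_divide_power_le_exp:
  fixes t :: real
  assumes "0 \<le> t" "n > 0"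
  shows "(1 + t / real n) ^ n \<le> exp t"
proof -
  have "(1 + t / real n) ^ n \<le> exp (t / real n) ^ n"
    using assms by (intro power_mono exp_ge_add_one_self) auto
  also have "\<dots> = exp t" using assms by (simp flip: exp_of_nat_mult)
  finally show ?thesis .
qed

text \<open>Squaring the modulus isolates Re x up to an error of order 1/n, and 1 + t <= exp t also
  holds for negative t. This gives decay on the left where x is not small.\<close>

lemma cmod_one_plus_divide_power_le:
  fixes x :: complex
  assumes "n > 0"
  shows "cmod (1 + x / of_nat n) ^ n \<le> exp (Re x + (cmod x)\<^sup>2 / (2 * real n))"
proof -
  define e where "e = (Re x + (cmod x)\<^sup>2 / (2 * real n)) / real n"
  have "(cmod (1 + x / of_nat n))\<^sup>2 = 1 + 2 * e"
    using assms by (simp add: e_def cmod_power2 power2_sum power_divide add_divide_distrib)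
      (simp add: power2_eq_square)
  also have "\<dots> \<le> exp e ^ 2"
    using exp_ge_add_one_self[of "2 * e"] by (simp add: exp_double)
  finally have "cmod (1 + x / of_nat n) \<le> exp e"
    by (rule power2_le_imp_le) simp
  then have "cmod (1 + x / of_nat n) ^ n \<le> exp e ^ n" by (intro power_mono) auto
  also have "\<dots> = exp (Re x + (cmod x)\<^sup>2 / (2 * real n))"
  proof -
    have "real n * e = Re x + (cmod x)\<^sup>2 / (2 * real n)" using assms by (simp add: e_def)
    then show ?thesis by (metis exp_of_nat_mult)
  qed
  finally show ?thesis .
qed

text \<open>The polynomial approximates \<open>exp (4 (w - 1))\<close>.\<close>
lemma separating_poly_rough:
  fixes R :: real
  obtains q :: "complex poly" where
    "\<And>w. cmod (w - 1) \<le> 1/20 \<Longrightarrow> cmod (poly q w - 1) \<le> 1/4"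
    "\<And>w. Re w \<le> 1/2 \<Longrightarrow> cmod w \<le> R \<Longrightarrow> cmod (poly q w) \<le> 1/4"
proof -
  \<comment> \<open>For x = 4 (w - 1) with |w| <= R, this makes the error |x|^2 / (2 n) at most 1/2.
    As Re x <= -2 on the half-plane, the exponent is at most -3/2.\<close>
  obtain n :: nat where n: "real n > 16 * (\<bar>R\<bar> + 1)\<^sup>2" using reals_Archimedean2 by blast
  have n0: "n > 0" using n by (intro gr0I) (auto simp: not_less)
  define q :: "complex poly" where "q = [:1 - 4 / of_nat n, 4 / of_nat n:] ^ n"
  have q: "poly q w = (1 + 4 * (w - 1) / of_nat n) ^ n" for w
  proof -
    have "1 - 4 / of_nat n + w * (4 / of_nat n) = 1 + 4 * (w - 1) / of_nat n"
      by (simp add: right_diff_distrib diff_divide_distrib)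
    then show ?thesis by (simp only: q_def poly_power poly_pCons poly_0 mult_zero_right add_0_right)
  qed
  show ?thesis
  proof (rule that[of q])
    fix w assume w: "cmod (w - 1) \<le> 1/20"
    have "cmod (poly q w - 1) \<le> (1 + cmod (4 * (w - 1) / of_nat n)) ^ n - 1"
      unfolding q by (rule norm_one_plus_power_minus_one_le)
    also have "\<dots> \<le> (1 + (1/5) / real n) ^ n - 1"
    proof -
      have "cmod (4 * (w - 1)) \<le> 1/5" unfolding norm_mult using w by simp
      then have "cmod (4 * (w - 1) / of_nat n) \<le> (1/5) / real n"
        unfolding norm_divide norm_of_nat by (rule divide_right_mono) simp
      then show ?thesis by (intro diff_mono power_mono add_mono) auto
    qed
    also have "\<dots> \<le> exp (1/5) - 1"
      using one_plus_divide_power_le_exp[of "1/5" n] n0 by simp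
    also have "\<dots> \<le> 1/4"
      using exp_bound[of "1/5"] by (simp add: power2_eq_square)
    finally show "cmod (poly q w - 1) \<le> 1/4" .
  next
    fix w assume w: "Re w \<le> 1/2" "cmod w \<le> R"
    have "cmod (4 * (w - 1)) \<le> 4 * (\<bar>R\<bar> + 1)"
      unfolding norm_mult using w norm_triangle_ineq4[of w 1] by simp
    then have "(cmod (4 * (w - 1)))\<^sup>2 \<le> (4 * (\<bar>R\<bar> + 1))\<^sup>2" by (intro power_mono) auto
    also have "\<dots> \<le> real n" using n unfolding power_mult_distrib by simp
    finally have "(cmod (4 * (w - 1)))\<^sup>2 / (2 * real n) \<le> 1/2"
      using n0 by (simp add: field_simps)
    moreover have "Re (4 * (w - 1)) \<le> -2" using w by simp
    ultimately have le: "Re (4 * (w - 1)) + (cmod (4 * (w - 1)))\<^sup>2 / (2 * real n) \<le> - (3/2)"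
      by linarith
    have "cmod (poly q w) \<le> exp (Re (4 * (w - 1)) + (cmod (4 * (w - 1)))\<^sup>2 / (2 * real n))"
      using cmod_one_plus_divide_power_le[OF n0, of "4 * (w - 1)"] by (simp add: q norm_power)
    also have "\<dots> \<le> exp (- (3/2))" using le by simp
    also have "\<dots> \<le> 1/4"
    proof -
      \<comment> \<open>The choice 12 gives the base 9/8, and (9/8)^12 exceeds 4.\<close>
      have "(1 + (3/2) / real 12) ^ 12 \<le> exp (3/2::real)"
        by (rule one_plus_divide_power_le_exp) auto
      then have "4 \<le> exp (3/2::real)" by (simp add: power_divide)
      then show ?thesis by (simp add: exp_minus field_simps)
    qed
    finally show "cmod (poly q w) \<le> 1/4" .
  qed
qed

text \<open>Accuracy is improved by iterating \<open>3x\<^sup>2 - 2x\<^sup>3\<close>, whose fixed points \<open>0\<close> and \<open>1\<close> are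
  superattracting.\<close>
lemma separating_poly:
  fixes R \<delta> :: real
  assumes "\<delta> > 0"
  obtains q :: "complex poly" where
    "\<And>w. cmod (w - 1) \<le> 1/20 \<Longrightarrow> cmod (poly q w - 1) \<le> \<delta>"
    "\<And>w. Re w \<le> 1/2 \<Longrightarrow> cmod w \<le> R \<Longrightarrow> cmod (poly q w) \<le> \<delta>"
proof -
  define s :: "complex poly" where "s = [:0, 0, 3, -2:]"
  have s: "poly s w = w\<^sup>2 * (3 - 2 * w)" for w
    by (simp add: s_def power2_eq_square algebra_simps)
  have contract: "cmod (poly s w) \<le> 7/8 * cmod w" if w: "cmod w \<le> 1/4" for w
  proof -
    have "cmod (3 - 2 * w) \<le> 7/2"
      using norm_triangle_ineq4[of 3 "2 * w"] w by (simp add: norm_mult)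
    then have "cmod w * (cmod w * cmod (3 - 2 * w)) \<le> cmod w * (1/4 * (7/2))"
      using w by (intro mult_left_mono mult_mono) auto
    then show ?thesis unfolding s norm_mult norm_power power2_eq_square by (simp add: mult.assoc)
  qed
  \<comment> \<open>The cubic commutes with w -> 1 - w, so the contraction near 0 yields the one
    near 1.\<close>
  have sym: "1 - poly s w = poly s (1 - w)" for w
    by (simp add: s power2_eq_square algebra_simps)
  obtain q0 :: "complex poly" where q0:
    "\<And>w. cmod (w - 1) \<le> 1/20 \<Longrightarrow> cmod (poly q0 w - 1) \<le> 1/4"
    "\<And>w. Re w \<le> 1/2 \<Longrightarrow> cmod w \<le> R \<Longrightarrow> cmod (poly q0 w) \<le> 1/4"
    using separating_poly_rough by blast
  define q where "q m = ((\<lambda>r. pcompose s r) ^^ m) q0" for m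
  have qS: "poly (q (Suc m)) w = poly s (poly (q m) w)" for m w
    by (simp add: q_def poly_pcompose)
  \<comment> \<open>This keeps every iterate in the disc of radius 1/4 where \<open>contract\<close>
    applies.\<close>
  have pow: "(7/8) ^ m * (1/4) \<le> (1/4::real)" for m by (simp add: power_le_one)
  have zero: "cmod (poly (q m) w) \<le> (7/8) ^ m * (1/4)" if "Re w \<le> 1/2" "cmod w \<le> R" for m w
  proof (induction m)
    case 0 then show ?case using q0(2)[OF that] by (simp add: q_def)
  next
    case (Suc m)
    then show ?case using contract[OF order_trans[OF Suc pow]] by (simp add: qS)
  qed
  have one: "cmod (1 - poly (q m) w) \<le> (7/8) ^ m * (1/4)" if "cmod (w - 1) \<le> 1/20" for m w
  proof (induction m)
    case 0 then show ?case using q0(1)[OF that] by (simp add: q_def norm_minus_commute)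
  next
    case (Suc m)
    then show ?case using contract[OF order_trans[OF Suc pow]] by (simp add: qS sym)
  qed
  obtain m where "(7/8) ^ m < \<delta>" using real_arch_pow_inv[OF assms, of "7/8"] by auto
  then have "(7/8) ^ m * (1/4) \<le> \<delta>" using assms zero_le_power[of "7/8::real" m] by linarith
  then show ?thesis using that[of "q m"] zero one
    by (metis norm_minus_commute order_trans)
qed

section \<open>One step of the recursion\<close>

text \<open>The order of choices matters: \<open>n\<close> depends on \<open>q\<close> and K only,
  it fixes the bound \<open>M\<close> of \<open>G\<close> on \<Sigma>, and \<open>\<psi>\<close> is
  chosen last to beat \<open>M\<close>. The tolerance 1/20 does not grow, because
  \<open>\<psi>\<close> first shrinks the error of \<open>F\<close> to \<open>\<delta>\<close> and
  only then \<open>G\<close> adds its own.\<close>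

lemma separating_cpoly_step:
  fixes \<Sigma> K :: "(complex^'n) set"
  assumes "compact \<Sigma>" "compact K" and F: "F \<in> cpoly" "\<And>z. z \<in> K \<Longrightarrow> cmod (F z - 1) \<le> 1/20"
    and q: "q \<in> cpoly" "\<And>z. z \<in> K \<Longrightarrow> cmod (q z) < 1"
  obtains F' where "F' \<in> cpoly" "\<And>z. z \<in> K \<Longrightarrow> cmod (F' z - 1) \<le> 1/20"
    "\<And>z. q z = 1 \<Longrightarrow> F' z = 0"
    "\<And>x. x \<in> \<Sigma> \<Longrightarrow> 1/2 \<le> Re (F' x) \<Longrightarrow> 1/2 \<le> Re (F x)"
proof -
  obtain \<rho> where \<rho>: "0 \<le> \<rho>" "\<rho> < 1" "\<And>z. z \<in> K \<Longrightarrow> cmod (q z) \<le> \<rho>"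
  proof (cases "K = {}")
    case True then show ?thesis using that[of 0] by simp
  next
    case False
    have "continuous_on K (\<lambda>w. cmod (q w))"
      using continuous_on_cpoly[OF q(1)] by (intro continuous_intros)
    then obtain y where "y \<in> K" "\<And>z. z \<in> K \<Longrightarrow> cmod (q z) \<le> cmod (q y)"
      using continuous_attains_sup[OF assms(2) False] by blast
    then show ?thesis using that[of "cmod (q y)"] q(2) by simp
  qed
  obtain n where n: "\<rho> ^ n < 1/40" using real_arch_pow_inv[of "1/40" \<rho>] \<rho> by auto
  define G where "G = (\<lambda>z. 1 - q z ^ n)"
  have G: "G \<in> cpoly" unfolding G_def by (intro cpoly_diff cpoly.const cpoly_power q)
  have GK: "cmod (G z - 1) \<le> 1/40" if "z \<in> K" for z
    using power_mono[OF \<rho>(3)[OF that], of n] n by (simp add: G_def norm_power)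
  obtain M where M: "0 < M" "\<And>x. x \<in> \<Sigma> \<Longrightarrow> cmod (G x) \<le> M"
    using compact_cpoly_bounded[OF assms(1) G] by blast
  obtain R where R: "\<And>x. x \<in> \<Sigma> \<Longrightarrow> cmod (F x) \<le> R"
    using compact_cpoly_bounded[OF assms(1) F(1)] by blast
  \<comment> \<open>The summand 80 serves the estimate on K; 4 M makes \<open>F'\<close> at most 1/4
    in modulus on the part of \<Sigma> where Re F < 1/2.\<close>
  define \<delta> where "\<delta> = 1 / (4 * M + 80)"
  have \<delta>: "\<delta> > 0" "\<delta> \<le> 1/80" "\<delta> * M \<le> 1/4" using M by (auto simp: \<delta>_def field_simps)
  obtain \<psi> :: "complex poly" where \<psi>:
    "\<And>w. cmod (w - 1) \<le> 1/20 \<Longrightarrow> cmod (poly \<psi> w - 1) \<le> \<delta>"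
    "\<And>w. Re w \<le> 1/2 \<Longrightarrow> cmod w \<le> R \<Longrightarrow> cmod (poly \<psi> w) \<le> \<delta>"
    using separating_poly[OF \<delta>(1)] by blast
  show ?thesis
  proof (rule that[of "\<lambda>z. poly \<psi> (F z) * G z"])
    show "(\<lambda>z. poly \<psi> (F z) * G z) \<in> cpoly"
      by (intro cpoly.mult cpoly_poly_comp F G)
  next
    fix z assume z: "z \<in> K"
    have "cmod (poly \<psi> (F z) * G z - 1) = cmod ((poly \<psi> (F z) - 1) * G z + (G z - 1))"
      by (simp add: algebra_simps)
    also have "\<dots> \<le> cmod (poly \<psi> (F z) - 1) * cmod (G z) + cmod (G z - 1)"
      by (metis norm_mult norm_triangle_ineq)
    also have "\<dots> \<le> 1/80 * (1 + 1/40) + 1/40"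
      using \<psi>(1)[OF F(2)[OF z]] \<delta>(2) GK[OF z] norm_triangle_ineq[of "G z - 1" 1]
      by (intro add_mono mult_mono) auto
    finally show "cmod (poly \<psi> (F z) * G z - 1) \<le> 1/20" by simp
  next
    fix z assume "q z = 1"
    then show "poly \<psi> (F z) * G z = 0" by (simp add: G_def)
  next
    fix x assume x: "x \<in> \<Sigma>" "1/2 \<le> Re (poly \<psi> (F x) * G x)"
    show "1/2 \<le> Re (F x)"
    proof (rule ccontr)
      assume "\<not> ?thesis"
      then have "cmod (poly \<psi> (F x)) \<le> \<delta>" using \<psi>(2) R x(1) by simp
      then have "cmod (poly \<psi> (F x) * G x) \<le> \<delta> * M"
        unfolding norm_mult using M(2)[OF x(1)] \<delta>(1) by (intro mult_mono) auto
      then show False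
        using x(2) \<delta>(3) complex_Re_le_cmod[of "poly \<psi> (F x) * G x"] by linarith
    qed
  qed
qed

section \<open>Countably many hypersurfaces meeting all discs outside K\<close>

text \<open>A polynomial that is nonconstant on the disc and of modulus above 1 at its centre takes,
  by openness, some value c from a countable dense set with |c| > 1. Division by c produces the
  value 1 and keeps the modulus below 1 on K.\<close>

lemma cpoly_family_meeting_discs:
  fixes K :: "(complex^'n) set"
  assumes "compact K" "poly_hull K = K"
  obtains Q :: "(complex^'n \<Rightarrow> complex) set"
  where "countable Q" "Q \<subseteq> cpoly" "\<And>q z. q \<in> Q \<Longrightarrow> z \<in> K \<Longrightarrow> cmod (q z) < 1"
    "\<And>\<sigma>. analytic_disc \<sigma> \<Longrightarrow> \<sigma> ` ball 0 1 \<subseteq> - K \<Longrightarrow> \<exists>q\<in>Q. \<exists>\<zeta>\<in>ball 0 1. q (\<sigma> \<zeta>) = 1"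
proof -
  define P :: "(complex^'n \<Rightarrow> complex) set" where "P = {q \<in> cpoly. \<forall>z\<in>K. cmod (q z) < 1}"
  define U :: "(complex^'n \<Rightarrow> complex) \<Rightarrow> (complex^'n) set" where "U q = {z. 1 < cmod (q z)}" for q
  have openU: "open S" if "S \<in> U ` P" for S
    using that by (auto simp: P_def U_def intro!: open_Collect_less continuous_intros continuous_on_cpoly)
  \<comment> \<open>Lindelof reduces the separation of all points outside K to countably many
    polynomials.\<close>
  obtain \<F> where \<F>: "\<F> \<subseteq> U ` P" "countable \<F>" "\<Union>\<F> = \<Union>(U ` P)"
    using Lindelof[of "U ` P"] openU by metis
  then obtain P' where P': "P' \<subseteq> P" "countable P'" "\<F> = U ` P'"
    by (metis countable_subset_image)
  have cover: "\<exists>p\<in>P'. 1 < cmod (p a)" if a: "a \<notin> K" for a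
  proof -
    obtain q where q: "q \<in> cpoly" "1 < cmod (q a)" "\<And>z. z \<in> K \<Longrightarrow> cmod (q z) < 1"
      using not_in_poly_hull_separate[OF assms(1), of a] a assms(2) by auto
    then have "a \<in> \<Union>(U ` P)" by (auto simp: P_def U_def)
    then show ?thesis using \<F>(3) P'(3) by (auto simp: U_def)
  qed
  obtain D :: "complex set" where D: "countable D" "\<And>X. open X \<Longrightarrow> X \<noteq> {} \<Longrightarrow> \<exists>d\<in>D. d \<in> X"
    using countable_dense_setE by blast
  \<comment> \<open>All parameters of the perturbed and rescaled polynomials range over countable
    sets; intersecting with \<open>P\<close> retains those of modulus below 1 on K.\<close>
  define h :: "(complex^'n \<Rightarrow> complex) \<times> 'n \<times> real \<times> complex \<Rightarrow> complex^'n \<Rightarrow> complex"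
    where "h = (\<lambda>(p, i, r, c) z. (p z + of_real r * z $ i) / c)"
  define Q where "Q = h ` (P' \<times> UNIV \<times> \<rat> \<times> D) \<inter> P"
  show ?thesis
  proof (rule that[of Q])
    have "countable (P' \<times> (UNIV :: 'n set) \<times> \<rat> \<times> D)"
      using P'(2) D(1) countable_rat by (intro countable_SIGMA) auto
    then show "countable Q" unfolding Q_def by (intro countable_Int1 countable_image)
    show "Q \<subseteq> cpoly" and "\<And>q z. q \<in> Q \<Longrightarrow> z \<in> K \<Longrightarrow> cmod (q z) < 1"
      by (auto simp: Q_def P_def)
  next
    fix \<sigma> :: "complex \<Rightarrow> complex^'n"
    assume \<sigma>: "analytic_disc \<sigma>" "\<sigma> ` ball 0 1 \<subseteq> - K"
    have hol: "(\<lambda>\<zeta>. \<sigma> \<zeta> $ i) holomorphic_on ball 0 1" for i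
      using \<sigma>(1) by (simp add: analytic_disc_def)
    have "\<sigma> 0 \<notin> K" using \<sigma>(2) by (auto simp: image_subset_iff)
    then obtain p where p: "p \<in> P'" "1 < cmod (p (\<sigma> 0))" using cover by blast
    then have pc: "p \<in> cpoly" and pK: "\<And>z. z \<in> K \<Longrightarrow> cmod (p z) < 1"
      using P'(1) by (auto simp: P_def)
    \<comment> \<open>Injectivity supplies a coordinate that is nonconstant along the disc; 1/2 is
      just a second point.\<close>
    have "\<sigma> 0 \<noteq> \<sigma> (1/2)"
      using \<sigma>(1) inj_onD[of \<sigma> "ball 0 1" 0 "1/2"] by (auto simp: analytic_disc_def)
    then obtain i where i: "\<sigma> 0 $ i \<noteq> \<sigma> (1/2) $ i" by (auto simp: vec_eq_iff)
    obtain B where B: "0 < B" "\<And>z. z \<in> insert (\<sigma> 0) K \<Longrightarrow> cmod (z $ i) \<le> B"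
      using compact_cpoly_bounded[OF _ cpoly.coord, of "insert (\<sigma> 0) K"] assms(1) by auto
    \<comment> \<open>A perturbation smaller than this slack preserves both strict inequalities, at
      the centre of the disc and on K.\<close>
    have "\<exists>\<epsilon>>0. \<epsilon> < cmod (p (\<sigma> 0)) - 1 \<and> (\<forall>z\<in>K. cmod (p z) + \<epsilon> < 1)"
    proof (cases "K = {}")
      case True then show ?thesis using p(2) dense[of 0 "cmod (p (\<sigma> 0)) - 1"] by auto
    next
      case False
      have "continuous_on K (\<lambda>w. cmod (p w))"
        using continuous_on_cpoly[OF pc] by (intro continuous_intros)
      then obtain y where y: "y \<in> K" "\<And>z. z \<in> K \<Longrightarrow> cmod (p z) \<le> cmod (p y)"
        using continuous_attains_sup[OF assms(1) False] by blast
      obtain \<epsilon> where "0 < \<epsilon>" "\<epsilon> < min (cmod (p (\<sigma> 0)) - 1) (1 - cmod (p y))"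
        using dense[of 0 "min (cmod (p (\<sigma> 0)) - 1) (1 - cmod (p y))"] p(2) pK[OF y(1)] by auto
      then show ?thesis using y(2) by (intro exI[of _ \<epsilon>]) fastforce
    qed
    then obtain \<epsilon> where \<epsilon>: "0 < \<epsilon>" "\<epsilon> < cmod (p (\<sigma> 0)) - 1" "\<And>z. z \<in> K \<Longrightarrow> cmod (p z) + \<epsilon> < 1"
      by blast
    define f where "f r = (\<lambda>z. p z + of_real r * z $ i)" for r :: real
    have fc: "f r \<in> cpoly" for r
      unfolding f_def by (intro cpoly.add cpoly.mult cpoly.const cpoly.coord pc)
    \<comment> \<open>If \<open>p\<close> itself is constant along the disc, a small multiple of a coordinate is added.\<close>
    obtain r where r: "r \<in> \<rat>" "0 \<le> r" "r * B < \<epsilon>" "f r (\<sigma> 0) \<noteq> f r (\<sigma> (1/2))"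
    proof (cases "p (\<sigma> 0) = p (\<sigma> (1/2))")
      case True
      obtain r where "r \<in> \<rat>" "0 < r" "r < \<epsilon> / B"
        using Rats_dense_in_real[of 0 "\<epsilon> / B"] \<epsilon>(1) B(1) by auto
      then show ?thesis using that[of r] True i B(1) by (simp add: f_def field_simps)
    next
      case False
      then show ?thesis using that[of 0] \<epsilon>(1) by (simp add: f_def)
    qed
    have small: "cmod (of_real r * z $ i) < \<epsilon>" if "z \<in> insert (\<sigma> 0) K" for z
      using mult_left_mono[OF B(2)[OF that] r(2)] r(2,3) by (simp add: norm_mult)
    have f0: "1 < cmod (f r (\<sigma> 0))"
      using norm_diff_ineq[of "p (\<sigma> 0)" "of_real r * \<sigma> 0 $ i"] small[of "\<sigma> 0"] \<epsilon>(2)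
      by (simp add: f_def)
    have fK: "cmod (f r z) < 1" if "z \<in> K" for z
      using norm_triangle_ineq[of "p z" "of_real r * z $ i"] small[of z] \<epsilon>(3)[OF that] that
      by (simp add: f_def)
    have "\<not> (\<lambda>\<zeta>. f r (\<sigma> \<zeta>)) constant_on ball 0 1"
    proof
      assume "(\<lambda>\<zeta>. f r (\<sigma> \<zeta>)) constant_on ball 0 1"
      then obtain c where "\<And>\<zeta>. \<zeta> \<in> ball 0 1 \<Longrightarrow> f r (\<sigma> \<zeta>) = c" by (auto simp: constant_on_def)
      from this[of 0] this[of "1/2"] show False using r(4) by simp
    qed
    then have "open ((\<lambda>\<zeta>. f r (\<sigma> \<zeta>)) ` ball 0 1)"
      by (intro open_mapping_thm[OF holomorphic_on_cpoly_comp[OF fc hol]]) auto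
    moreover have "open {w :: complex. 1 < cmod w}"
      by (intro open_Collect_less continuous_intros)
    ultimately have "open ((\<lambda>\<zeta>. f r (\<sigma> \<zeta>)) ` ball 0 1 \<inter> {w. 1 < cmod w})" by (rule open_Int)
    moreover have "f r (\<sigma> 0) \<in> (\<lambda>\<zeta>. f r (\<sigma> \<zeta>)) ` ball 0 1 \<inter> {w. 1 < cmod w}"
      using f0 by auto
    ultimately obtain c where c: "c \<in> D" "c \<in> (\<lambda>\<zeta>. f r (\<sigma> \<zeta>)) ` ball 0 1 \<inter> {w. 1 < cmod w}"
      using D(2) by blast
    then obtain \<zeta> where \<zeta>: "\<zeta> \<in> ball 0 1" "f r (\<sigma> \<zeta>) = c" and c1: "1 < cmod c" by auto
    have heq: "h (p, i, r, c) = (\<lambda>z. f r z / c)" by (simp add: h_def f_def)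
    have "cmod (f r z / c) < 1" if "z \<in> K" for z
      using fK[OF that] c1 by (simp add: norm_divide divide_less_eq)
    then have "(\<lambda>z. f r z / c) \<in> P" using cpoly_divide[OF fc] by (simp add: P_def)
    moreover have "(\<lambda>z. f r z / c) \<in> h ` (P' \<times> UNIV \<times> \<rat> \<times> D)"
      using p(1) r(1) c(1) by (intro image_eqI[where x = "(p, i, r, c)"]) (auto simp: heq)
    ultimately have "(\<lambda>z. f r z / c) \<in> Q" by (simp add: Q_def)
    moreover have "f r (\<sigma> \<zeta>) / c = 1" using \<zeta>(2) c1 by auto
    ultimately show "\<exists>q\<in>Q. \<exists>\<zeta>\<in>ball 0 1. q (\<sigma> \<zeta>) = 1"
      using \<zeta>(1) by (intro bexI[of _ "\<lambda>z. f r z / c"] bexI[of _ \<zeta>])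
  qed
qed

section \<open>Construction of X and its two properties\<close>

theorem theorem5p1:
  fixes \<Sigma> K :: "(complex^'n) set" and k :: nat
  assumes "CARD('n) \<ge> 2"
    and "compact \<Sigma>"
    and "2 \<le> k" and "k \<le> CARD('n)"
    and "compact K" and "poly_hull K = K"
    and "K \<subseteq> kpoly_hull k \<Sigma>"
  shows "\<exists>X. compact X \<and> X \<subseteq> \<Sigma> \<and> K \<subseteq> rat_hull (k - 1) X \<and>
             contains_no_discs (poly_hull X - K)"
proof -
  obtain Q :: "(complex^'n \<Rightarrow> complex) set" where Q: "countable Q" "Q \<subseteq> cpoly"
    "\<And>q z. q \<in> Q \<Longrightarrow> z \<in> K \<Longrightarrow> cmod (q z) < 1"
    "\<And>\<sigma>. analytic_disc \<sigma> \<Longrightarrow> \<sigma> ` ball 0 1 \<subseteq> - K \<Longrightarrow> \<exists>q\<in>Q. \<exists>\<zeta>\<in>ball 0 1. q (\<sigma> \<zeta>) = 1"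
    by (rule cpoly_family_meeting_discs[OF assms(5,6)]) blast
  \<comment> \<open>Inserting the zero function makes the family nonempty, hence enumerable; its
    modulus is below 1 on K, so the recursion accepts it.\<close>
  define q where "q = from_nat_into (insert (\<lambda>_. 0) Q)"
  have range_q: "range q = insert (\<lambda>_. 0) Q"
    unfolding q_def using Q(1) by (intro range_from_nat_into) auto
  have q: "q n \<in> cpoly" "\<And>z. z \<in> K \<Longrightarrow> cmod (q n z) < 1" for n
  proof -
    have "q n \<in> insert (\<lambda>_. 0) Q" using range_q by (metis rangeI)
    then show "q n \<in> cpoly" "\<And>z. z \<in> K \<Longrightarrow> cmod (q n z) < 1"
      using Q(2,3) cpoly.const[of 0] by auto
  qed
  have "\<exists>F. \<forall>n. (F n \<in> cpoly \<and> (\<forall>z\<in>K. cmod (F n z - 1) \<le> 1/20)) \<and>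
      ((\<forall>z. q n z = 1 \<longrightarrow> F (Suc n) z = 0) \<and>
       (\<forall>x\<in>\<Sigma>. 1/2 \<le> Re (F (Suc n) x) \<longrightarrow> 1/2 \<le> Re (F n x)))"
  proof (rule dependent_nat_choice)
    show "\<exists>F. F \<in> cpoly \<and> (\<forall>z\<in>K. cmod (F z - 1) \<le> 1/20)"
      using cpoly.const[of 1] by (intro exI[of _ "\<lambda>_. 1"]) simp
  next
    fix F :: "complex^'n \<Rightarrow> complex" and n
    assume F: "F \<in> cpoly \<and> (\<forall>z\<in>K. cmod (F z - 1) \<le> 1/20)"
    obtain F' where "F' \<in> cpoly" "\<And>z. z \<in> K \<Longrightarrow> cmod (F' z - 1) \<le> 1/20"
      "\<And>z. q n z = 1 \<Longrightarrow> F' z = 0"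
      "\<And>x. x \<in> \<Sigma> \<Longrightarrow> 1/2 \<le> Re (F' x) \<Longrightarrow> 1/2 \<le> Re (F x)"
      by (rule separating_cpoly_step[OF assms(2,5), of F "q n"]) (use F q in auto)
    then show "\<exists>F'. (F' \<in> cpoly \<and> (\<forall>z\<in>K. cmod (F' z - 1) \<le> 1/20)) \<and>
        (\<forall>z. q n z = 1 \<longrightarrow> F' z = 0) \<and> (\<forall>x\<in>\<Sigma>. 1/2 \<le> Re (F' x) \<longrightarrow> 1/2 \<le> Re (F x))"
      by blast
  qed
  then obtain F where F: "\<And>n. F n \<in> cpoly" "\<And>n z. z \<in> K \<Longrightarrow> cmod (F n z - 1) \<le> 1/20"
      "\<And>n z. q n z = 1 \<Longrightarrow> F (Suc n) z = 0"
      "\<And>n x. x \<in> \<Sigma> \<Longrightarrow> 1/2 \<le> Re (F (Suc n) x) \<Longrightarrow> 1/2 \<le> Re (F n x)"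
    by blast
  have closedF: "closed {x. 1/2 \<le> Re (F n x)}" for n
    using continuous_on_cpoly[OF F(1)] by (intro closed_Collect_le continuous_intros)
  have mono: "{x\<in>\<Sigma>. 1/2 \<le> Re (F n x)} \<subseteq> {x\<in>\<Sigma>. 1/2 \<le> Re (F m x)}" if "m \<le> n" for m n
    using lift_Suc_antimono_le[of "\<lambda>n. {x\<in>\<Sigma>. 1/2 \<le> Re (F n x)}", OF _ that] F(4) by blast
  define X where "X = \<Sigma> \<inter> (\<Inter>n. {x. 1/2 \<le> Re (F n x)})"
  have X: "compact X" unfolding X_def using assms(2) closedF by (intro compact_Int_closed closed_INT) auto
  have hull: "1/2 \<le> Re (F n z)" if z: "z \<in> poly_hull X" for n z
  proof -
    obtain y where "y \<in> X" "Re (F n y) \<le> Re (F n z)"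
      using poly_hull_Re_le[OF X z F(1)] by blast
    moreover from this(1) have "1/2 \<le> Re (F n y)" by (simp add: X_def)
    ultimately show ?thesis by linarith
  qed
  have "K \<subseteq> rat_hull (k - 1) X"
    unfolding rat_hull_def
  proof safe
    fix z V m
    assume z: "z \<in> K" "m \<le> k - 1" "pure_codim_subvariety V m" "z \<in> V" and empty: "V \<inter> X = {}"
    then have zV: "z \<in> poly_hull (\<Sigma> \<inter> V)"
      using assms(7) by (auto simp: kpoly_hull_def)
    have "closed V" using z(3) by (simp add: pure_codim_subvariety_def analytic_subvariety_def)
    then have compV: "compact (\<Sigma> \<inter> V)" using assms(2) by (intro compact_Int_closed)
    define S where "S n = \<Sigma> \<inter> V \<inter> {x. 1/2 \<le> Re (F n x)}" for n
    \<comment> \<open>A common point of these nested compact sets lies in V and X, so it suffices to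
      meet each stage separately.\<close>
    have "\<Inter>(range S) \<noteq> {}"
    proof (rule compact_nest)
      show "compact (S n)" for n unfolding S_def using compact_Int_closed[OF compV closedF] .
      show "S n \<noteq> {}" for n
      proof -
        \<comment> \<open>At z the real part of \<open>F n\<close> is at least 19/20, so this point
          of \<Sigma> \<inter> V clears the threshold 1/2.\<close>
        obtain y where y: "y \<in> \<Sigma> \<inter> V" "Re (F n z) \<le> Re (F n y)"
          using poly_hull_Re_ge[OF compV zV F(1)] by blast
        have "1 - Re (F n z) \<le> 1/20"
          using F(2)[OF z(1), of n] complex_Re_le_cmod[of "1 - F n z"]
          by (simp add: norm_minus_commute)
        then show ?thesis using y by (auto simp: S_def)
      qed
      show "S n \<subseteq> S m" if "m \<le> n" for m n using mono[OF that] by (auto simp: S_def)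
    qed
    then show False using empty by (auto simp: S_def X_def)
  qed
  moreover have "contains_no_discs (poly_hull X - K)"
    unfolding contains_no_discs_def
  proof safe
    fix \<sigma> assume \<sigma>: "analytic_disc \<sigma>" "\<sigma> ` ball 0 1 \<subseteq> poly_hull X - K"
    then obtain p \<zeta> where p: "p \<in> Q" "\<zeta> \<in> ball 0 1" "p (\<sigma> \<zeta>) = 1" using Q(4)[of \<sigma>] by blast
    then obtain n where "p = q n" using range_q by blast
    then have "F (Suc n) (\<sigma> \<zeta>) = 0" using F(3) p(3) by blast
    moreover have "\<sigma> \<zeta> \<in> poly_hull X" using \<sigma>(2) p(2) by blast
    ultimately show False using hull[of "\<sigma> \<zeta>" "Suc n"] by simp
  qed
  moreover have "X \<subseteq> \<Sigma>" by (simp add: X_def)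
  ultimately show ?thesis using X by blast
qed

end
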